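(* Let $z,z'\in\mathbb C$. For every partition $\nu\in\mathbb Y$, the Laguerre symmetric function $\mathfrak L_\nu$ with parameters $(z,z')$ is an eigenvector of the Laguerre operator $\mathfrak D^{\mathsf L}:\mathrm{Sym}_{\mathbb C}\to\mathrm{Sym}_{\mathbb C}$ with the same parameters: $$\mathfrak D^{\mathsf L}\mathfrak L_\nu=-|\nu|\,\mathfrak L_\nu .$$
   Context: $\mathbb Y$ is the set of all partitions, identified with Young diagrams; $|\nu|$ is the number of boxes of $\nu$. $\mathrm{Sym}$ is the algebra of symmetric functions over $\mathbb R$, $\mathrm{Sym}_{\mathbb C}=\mathrm{Sym}\otimes_{\mathbb R}\mathbb C$, and $S_\nu$ ($\nu\in\mathbb Y$) are the Schur symmetric functions, which form a basis. For a box $\square=(i,j)$ (row $i$, column $j$) its content is $c(\square)=j-i$. For $\mu\subseteq\nu$, $(z)_{\nu/\mu}=\prod_{\square\in\nu/\mu}(z+c(\square))$, and $\dim\nu/\mu$ is the number of standard tableaux of skew shape $\nu/\mu$ (equal to $1$ if $\mu=\nu$). The Laguerre symmetric function with index $\nu$ and parameters $(z,z')$ is $$\mathfrak L_\nu=\sum_{\mu\subseteq\nu}(-1)^{|\nu|-|\mu|}\frac{\dim\nu/\mu}{(|\nu|-|\mu|)!}(z)_{\nu/\mu}(z')_{\nu/\mu}S_\mu .$$ $\nu^-$ denotes the set of corner boxes of $\nu$, i.e. boxes $\square\in\nu$ such that $\nu\setminus\square$ is again a Young diagram. The Laguerre operator with parameters $z,z'$ is the linear operator on $\mathrm{Sym}_{\mathbb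 C}$ defined by $$\mathfrak D^{\mathsf L}S_\nu=-|\nu|S_\nu+\sum_{\square\in\nu^-}(z+c(\square))(z'+c(\square))S_{\nu\setminus\square},\qquad \nu\in\mathbb Y.$$ *)

theory Defs
  imports
    Complex_Main
    "HOL-Library.FuncSet"
    "HOL-Library.Multiset"
    "HOL-Combinatorics.Permutations"
begin

section \<open>Young diagrams\<close>

text \<open>
  A partition is identified with its Young diagram, a finite set of boxes \<open>(i, j)\<close>
  (row, column) closed under moving up and to the left. Rows and columns are numbered
  from 0, which does not affect the contents \<open>j - i\<close>; \<open>card \<nu>\<close> is the size of \<open>\<nu>\<close>.
\<close>

type_synonym box = "nat \<times> nat"

definition young_diagram :: "box set \<Rightarrow> bool" where
  "young_diagram \<nu> \<longleftrightarrow>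
     finite \<nu> \<and> (\<forall>i j i' j'. (i, j) \<in> \<nu> \<and> i' \<le> i \<and> j' \<le> j \<longrightarrow> (i', j') \<in> \<nu>)"

definition content :: "box \<Rightarrow> int" where
  "content b = int (snd b) - int (fst b)"

definition corners :: "box set \<Rightarrow> box set" where
  "corners \<nu> = {b \<in> \<nu>. young_diagram (\<nu> - {b})}"

definition standard_tableaux :: "box set \<Rightarrow> (box \<Rightarrow> nat) set" where
  "standard_tableaux \<theta> =
     {T \<in> extensional \<theta>. bij_betw T \<theta> {1..card \<theta>} \<and>
        (\<forall>i j j'. (i, j) \<in> \<theta> \<and> (i, j') \<in> \<theta> \<and> j < j' \<longrightarrow> T (i, j) < T (i, j')) \<and>
        (\<forall>i i' j. (i, j) \<in> \<theta> \<and> (i', j) \<in> \<theta> \<and> i < i' \<longrightarrow> T (i, j) < T (i', j))}"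

definition skew_dim :: "box set \<Rightarrow> box set \<Rightarrow> nat" where
  "skew_dim \<nu> \<mu> = card (standard_tableaux (\<nu> - \<mu>))"

definition skew_poch :: "complex \<Rightarrow> box set \<Rightarrow> box set \<Rightarrow> complex" where
  "skew_poch z \<nu> \<mu> = (\<Prod>b\<in>\<nu> - \<mu>. z + of_int (content b))"


section \<open>Symmetric functions\<close>

text \<open>
  A formal power series in the variables \<open>x\<^sub>0, x\<^sub>1, \<dots>\<close> is given by its coefficient
  function; the monomial \<open>x\<^bsub>k1\<^esub> \<cdots> x\<^bsub>kn\<^esub>\<close> is encoded as the multiset of the indices
  \<open>k1, \<dots>, kn\<close>, so that its degree is the size of the multiset.
  Symmetric functions are the series of bounded degree that are invariant under
  the finitary permutations of the variables. Complex coefficients are used throughout,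
  i.e. \<open>sym\<close> is the complexification of the algebra of real symmetric functions;
  only its vector space structure is needed.
\<close>

typedef sym =
  "{f :: nat multiset \<Rightarrow> complex.
      (\<exists>d. \<forall>m. f m \<noteq> 0 \<longrightarrow> size m \<le> d) \<and>
      (\<forall>\<pi> m. permutation \<pi> \<longrightarrow> f (image_mset \<pi> m) = f m)}"
  morphisms coeff_sym Abs_sym
  by (rule exI[of _ "\<lambda>_. 0"]) simp

setup_lifting type_definition_sym

instantiation sym :: ab_group_add
begin

lift_definition zero_sym :: sym is "\<lambda>_. 0" by simp

lift_definition plus_sym :: "sym \<Rightarrow> sym \<Rightarrow> sym" is "\<lambda>f g m. f m + g m"
proof (intro conjI)
  fix f g :: "nat multiset \<Rightarrow> complex"
  assume f: "(\<exists>d. \<forall>m. f m \<noteq> 0 \<longrightarrow> size m \<le> d) \<and>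
      (\<forall>\<pi> m. permutation \<pi> \<longrightarrow> f (image_mset \<pi> m) = f m)"
    and g: "(\<exists>d. \<forall>m. g m \<noteq> 0 \<longrightarrow> size m \<le> d) \<and>
      (\<forall>\<pi> m. permutation \<pi> \<longrightarrow> g (image_mset \<pi> m) = g m)"
  from f obtain d where d: "\<And>m. f m \<noteq> 0 \<Longrightarrow> size m \<le> d" by blast
  from g obtain e where e: "\<And>m. g m \<noteq> 0 \<Longrightarrow> size m \<le> e" by blast
  have "size m \<le> max d e" if "f m + g m \<noteq> 0" for m
    using that d[of m] e[of m] by (cases "f m = 0") auto
  then show "\<exists>d. \<forall>m. f m + g m \<noteq> 0 \<longrightarrow> size m \<le> d" by blast
  show "\<forall>\<pi> m. permutation \<pi> \<longrightarrow>
      f (image_mset \<pi> m) + g (image_mset \<pi> m) = f m + g m"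
    using f g by simp
qed

lift_definition uminus_sym :: "sym \<Rightarrow> sym" is "\<lambda>f m. - f m" by simp

lift_definition minus_sym :: "sym \<Rightarrow> sym \<Rightarrow> sym" is "\<lambda>f g m. f m - g m"
proof (intro conjI)
  fix f g :: "nat multiset \<Rightarrow> complex"
  assume f: "(\<exists>d. \<forall>m. f m \<noteq> 0 \<longrightarrow> size m \<le> d) \<and>
      (\<forall>\<pi> m. permutation \<pi> \<longrightarrow> f (image_mset \<pi> m) = f m)"
    and g: "(\<exists>d. \<forall>m. g m \<noteq> 0 \<longrightarrow> size m \<le> d) \<and>
      (\<forall>\<pi> m. permutation \<pi> \<longrightarrow> g (image_mset \<pi> m) = g m)"
  from f obtain d where d: "\<And>m. f m \<noteq> 0 \<Longrightarrow> size m \<le> d" by blast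
  from g obtain e where e: "\<And>m. g m \<noteq> 0 \<Longrightarrow> size m \<le> e" by blast
  have "size m \<le> max d e" if "f m - g m \<noteq> 0" for m
    using that d[of m] e[of m] by (cases "f m = 0") auto
  then show "\<exists>d. \<forall>m. f m - g m \<noteq> 0 \<longrightarrow> size m \<le> d" by blast
  show "\<forall>\<pi> m. permutation \<pi> \<longrightarrow>
      f (image_mset \<pi> m) - g (image_mset \<pi> m) = f m - g m"
    using f g by simp
qed

instance
  by standard (transfer; simp add: fun_eq_iff algebra_simps)+

end

lift_definition scale_sym :: "complex \<Rightarrow> sym \<Rightarrow> sym" (infixr "*\<^sub>S" 75)
  is "\<lambda>c f m. c * f m"
  by (metis (no_types, lifting) mult_zero_right)

interpretation sym: vector_space scale_sym
  by unfold_locales (transfer; simp add: fun_eq_iff algebra_simps)+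

interpretation sym: vector_space_pair scale_sym scale_sym
  by unfold_locales

definition semistandard_tableaux :: "box set \<Rightarrow> (box \<Rightarrow> nat) set" where
  "semistandard_tableaux \<nu> =
     {T \<in> extensional \<nu>.
        (\<forall>i j j'. (i, j) \<in> \<nu> \<and> (i, j') \<in> \<nu> \<and> j < j' \<longrightarrow> T (i, j) \<le> T (i, j')) \<and>
        (\<forall>i i' j. (i, j) \<in> \<nu> \<and> (i', j) \<in> \<nu> \<and> i < i' \<longrightarrow> T (i, j) < T (i', j))}"

text \<open>
  The Schur function is the generating function of semistandard tableaux:
  \<open>S\<^sub>\<nu> = (\<Sum>T. \<Prod>b\<in>\<nu>. x\<^bsub>T b\<^esub>)\<close>. It is homogeneous of degree \<open>card \<nu>\<close>
  and, by the Bender--Knuth involutions, symmetric, so that \<open>Abs_sym\<close> is applied to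
  an element of the representing set.
\<close>

definition schur :: "box set \<Rightarrow> sym" where
  "schur \<nu> = Abs_sym (\<lambda>m. of_nat (card {T \<in> semistandard_tableaux \<nu>.
                                          image_mset T (mset_set \<nu>) = m}))"


section \<open>Laguerre symmetric functions and the Laguerre operator\<close>

definition laguerre_sym :: "complex \<Rightarrow> complex \<Rightarrow> box set \<Rightarrow> sym" where
  "laguerre_sym z z' \<nu> =
     (\<Sum>\<mu> | young_diagram \<mu> \<and> \<mu> \<subseteq> \<nu>.
        ((- 1) ^ (card \<nu> - card \<mu>) * of_nat (skew_dim \<nu> \<mu>) / fact (card \<nu> - card \<mu>)
           * skew_poch z \<nu> \<mu> * skew_poch z' \<nu> \<mu>) *\<^sub>S schur \<mu>)"

definition laguerre_op_schur :: "complex \<Rightarrow> complex \<Rightarrow> box set \<Rightarrow> sym" where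
  "laguerre_op_schur z z' \<nu> =
     (- of_nat (card \<nu>)) *\<^sub>S schur \<nu>
     + (\<Sum>b\<in>corners \<nu>.
          ((z + of_int (content b)) * (z' + of_int (content b))) *\<^sub>S schur (\<nu> - {b}))"

text \<open>
  The Schur functions form a basis of \<open>sym\<close>, and \<open>laguerre_op z z'\<close> is the linear
  extension of \<open>schur \<nu> \<mapsto> laguerre_op_schur z z' \<nu>\<close> from this basis. The operator
  \<open>construct\<close> takes the values as a function of the basis vector, hence the inverse
  of \<open>schur\<close> on the set of Young diagrams.
\<close>

definition laguerre_op :: "complex \<Rightarrow> complex \<Rightarrow> sym \<Rightarrow> sym" where
  "laguerre_op z z' =
     sym.construct (schur ` Collect young_diagram)
       (\<lambda>s. laguerre_op_schur z z' (the_inv_into (Collect young_diagram) schur s))"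

end

theory Submission
  imports Defs
begin

text \<open>
  Write \<open>a\<^bsub>\<nu>\<mu>\<^esub>\<close> for the coefficient of \<open>S\<^sub>\<mu>\<close> in the Laguerre function of \<open>\<nu>\<close> and
  \<open>w(b) = (z + c(b)) (z' + c(b))\<close>. Comparing the coefficients of \<open>S\<^sub>\<kappa>\<close> on both sides of the
  eigenvector equation reduces it to
  \<open>(\<Sum>b. w(b) a\<^bsub>\<nu>,\<kappa>\<union>{b}\<^esub>) = (|\<kappa>| - |\<nu>|) a\<^bsub>\<nu>\<kappa>\<^esub>\<close>, the sum being over the boxes \<open>b\<close> of \<open>\<nu>\<close> that
  can be added to \<open>\<kappa>\<close> (\<open>laguerre_coeff_recursion\<close>). The weights complete the products
  \<open>(z)\<close> and \<open>(z')\<close> over \<open>\<nu>/\<kappa>\<close>, so for \<open>\<kappa> \<noteq> \<nu>\<close> this is the recursion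
  \<open>dim \<nu>/\<kappa> = (\<Sum>b. dim \<nu>/(\<kappa>\<union>{b}))\<close>, obtained by removing the box with entry 1 from a
  standard tableau (\<open>skew_dim_recursion\<close>).

  To evaluate the operator on the Schur functions, and to see that the Laguerre function,
  in which \<open>S\<^sub>\<nu>\<close> has coefficient 1, is not zero, one needs their linear independence
  (\<open>schur_sum_eq_0D\<close>, \<open>independent_schur\<close>). Let \<open>n(\<nu>)\<close> be the sum of the row indices of the
  boxes of \<open>\<nu>\<close>. In a semistandard tableau of shape \<open>\<nu>\<close> each entry is at least its row index, so
  if it contributes to the monomial \<open>x\<^sup>\<mu>\<close> then \<open>n(\<nu>) \<le> n(\<mu>)\<close>, with equality only if
  \<open>\<nu> = \<mu>\<close>, and then there is exactly one such tableau. Hence the Kostka numbers are unitriangular with respect to \<open>n\<close>.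

  Coefficients of \<open>S\<^sub>\<nu>\<close> can be read off as numbers of tableaux only once the generating function
  of semistandard tableaux is known to be symmetric (\<open>coeff_schur\<close>). This is proved with the
  Bender--Knuth involutions, described through row counts: a tableau is a chain of diagrams
  formed by the boxes with entries less than \<open>c\<close>, successive ones differing by a horizontal
  strip. When all members of the chain except one are kept, each row length of the remaining
  one ranges independently over an interval, and the involution reflects it in that interval.
\<close>

section \<open>Symmetry of Schur functions\<close>

text \<open>The number of entries less than \<open>c\<close> in row \<open>i\<close> of \<open>T\<close>.\<close>

definition row_count :: "box set \<Rightarrow> (box \<Rightarrow> nat) \<Rightarrow> nat \<Rightarrow> nat \<Rightarrow> nat" where
  "row_count \<nu> T c i = card {j. (i, j) \<in> \<nu> \<and> T (i, j) < c}"

text \<open>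
  \<open>g\<close> describes \<open>T\<close>: for every \<open>c\<close>, the boxes with entry less than \<open>c\<close> are the first
  \<open>g c i\<close> boxes of row \<open>i\<close>, for all \<open>i\<close>. On \<open>\<nu>\<close> the tableau is determined by \<open>g\<close>.
\<close>

definition encodes :: "box set \<Rightarrow> (box \<Rightarrow> nat) \<Rightarrow> (nat \<Rightarrow> nat \<Rightarrow> nat) \<Rightarrow> bool" where
  "encodes \<nu> T g \<longleftrightarrow> (\<forall>c i j. (i, j) \<in> \<nu> \<and> T (i, j) < c \<longleftrightarrow> j < g c i)"

lemma encodesD: "encodes \<nu> T g \<Longrightarrow> (i, j) \<in> \<nu> \<and> T (i, j) < c \<longleftrightarrow> j < g c i"
  unfolding encodes_def by (elim allE)

lemma young_diagramD:
  "young_diagram \<nu> \<Longrightarrow> (i, j) \<in> \<nu> \<Longrightarrow> i' \<le> i \<Longrightarrow> j' \<le> j \<Longrightarrow> (i', j') \<in> \<nu>"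
  unfolding young_diagram_def by blast

lemma young_diagram_finite: "young_diagram \<nu> \<Longrightarrow> finite \<nu>"
  unfolding young_diagram_def by blast

lemma finite_row: "finite \<nu> \<Longrightarrow> finite {j. (i, j) \<in> \<nu> \<and> P j}"
  by (rule finite_subset[of _ "snd ` \<nu>"]) force+

lemma lower_set_eq_lessThan:
  fixes A :: "nat set"
  assumes "finite A" and "\<And>j j'. j \<in> A \<Longrightarrow> j' \<le> j \<Longrightarrow> j' \<in> A"
  shows "A = {..<card A}"
proof (cases "A = {}")
  case False
  have "A = {..Max A}"
    using assms False by (auto intro: Max_ge Max_in)
  then have "card A = Suc (Max A)"
    by (metis card_atMost)
  with \<open>A = {..Max A}\<close> show ?thesis
    by (simp add: lessThan_Suc_atMost)
qed simp

lemma semistandard_rowD: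
  "\<lbrakk>T \<in> semistandard_tableaux \<nu>; (i, j) \<in> \<nu>; (i, j') \<in> \<nu>; j \<le> j'\<rbrakk> \<Longrightarrow> T (i, j) \<le> T (i, j')"
  unfolding semistandard_tableaux_def by (cases "j = j'") auto

lemma semistandard_colD:
  "\<lbrakk>T \<in> semistandard_tableaux \<nu>; (i, j) \<in> \<nu>; (i', j) \<in> \<nu>; i < i'\<rbrakk> \<Longrightarrow> T (i, j) < T (i', j)"
  unfolding semistandard_tableaux_def by auto

lemma encodes_row_count:
  assumes "young_diagram \<nu>" "T \<in> semistandard_tableaux \<nu>"
  shows "encodes \<nu> T (row_count \<nu> T)"
  unfolding encodes_def
proof (intro allI)
  fix c i j
  let ?A = "{j. (i, j) \<in> \<nu> \<and> T (i, j) < c}"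
  have "?A = {..<card ?A}"
  proof (rule lower_set_eq_lessThan)
    show "finite ?A"
      by (rule finite_row[OF young_diagram_finite[OF assms(1)]])
  next
    fix j j' assume "j \<in> ?A" "j' \<le> j"
    moreover from this have "(i, j') \<in> \<nu>"
      using young_diagramD[OF assms(1)] by blast
    ultimately show "j' \<in> ?A"
      using semistandard_rowD[OF assms(2), of i j' j] by auto
  qed
  then have "j \<in> ?A \<longleftrightarrow> j \<in> {..<card ?A}"
    by (rule arg_cong[where f = "\<lambda>A. j \<in> A"])
  then show "(i, j) \<in> \<nu> \<and> T (i, j) < c \<longleftrightarrow> j < row_count \<nu> T c i"
    by (simp add: row_count_def)
qed

lemma encodes_imp_row_count:
  assumes "encodes \<nu> T g"
  shows "row_count \<nu> T = g"
proof (intro ext)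
  fix c i
  have "{j. (i, j) \<in> \<nu> \<and> T (i, j) < c} = {..<g c i}"
    using encodesD[OF assms, of i] by auto
  then show "row_count \<nu> T c i = g c i"
    by (simp add: row_count_def)
qed

lemma encodes_inj:
  assumes "encodes \<nu> T g" "encodes \<nu> T' g" "T \<in> extensional \<nu>" "T' \<in> extensional \<nu>"
  shows "T = T'"
proof (rule extensionalityI[OF assms(3,4)])
  fix b assume b: "b \<in> \<nu>"
  obtain i j where [simp]: "b = (i, j)" by (cases b)
  have "T b < c \<longleftrightarrow> T' b < c" for c
    using encodesD[OF assms(1), of i j c] encodesD[OF assms(2), of i j c] b by simp
  then show "T b = T' b"
    by (metis linorder_neqE_nat less_irrefl)
qed

lemma encodes_mono:
  assumes "encodes \<nu> T g" "c \<le> c'"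
  shows "g c i \<le> g c' i"
proof (rule ccontr)
  assume "\<not> ?thesis"
  then have "g c' i < g c i" by simp
  then have "(i, g c' i) \<in> \<nu> \<and> T (i, g c' i) < c"
    using encodesD[OF assms(1)] by blast
  then have "g c' i < g c' i"
    using encodesD[OF assms(1), of i "g c' i" c'] assms(2) by simp
  then show False by simp
qed

text \<open>
  Strictness down the columns: the boxes with entry \<open>c\<close> form a horizontal strip. Conversely,
  this interlacing makes a filling encoded by \<open>g\<close> semistandard.
\<close>

lemma row_count_interlace:
  assumes "young_diagram \<nu>" "T \<in> semistandard_tableaux \<nu>"
  shows "row_count \<nu> T (Suc c) (Suc i) \<le> row_count \<nu> T c i" (is "?a \<le> ?b")
proof (rule ccontr)
  assume "\<not> ?thesis"
  then have less: "?b < ?a" by simp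
  note enc = encodes_row_count[OF assms]
  have 1: "(Suc i, ?b) \<in> \<nu>" "T (Suc i, ?b) < Suc c"
    using less encodesD[OF enc] by blast+
  then have 2: "(i, ?b) \<in> \<nu>"
    using young_diagramD[OF assms(1), of "Suc i" ?b i ?b] by simp
  have "T (i, ?b) < c"
    using semistandard_colD[OF assms(2) 2 1(1)] 1(2) by simp
  then have "?b < ?b"
    using 2 encodesD[OF enc] by blast
  then show False by simp
qed

lemma semistandardI_encodes:
  assumes \<nu>: "young_diagram \<nu>" and ext: "T \<in> extensional \<nu>" and enc: "encodes \<nu> T g"
    and inter: "\<And>c i. g (Suc c) (Suc i) \<le> g c i"
  shows "T \<in> semistandard_tableaux \<nu>"
proof -
  have iff: "T (i, j) < c \<longleftrightarrow> j < g c i" if "(i, j) \<in> \<nu>" for i j c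
    using encodesD[OF enc] that by blast
  have row: "T (i, j) \<le> T (i, j')" if "(i, j) \<in> \<nu>" "(i, j') \<in> \<nu>" "j < j'" for i j j'
    using iff[OF that(1), of "Suc (T (i, j'))"] iff[OF that(2), of "Suc (T (i, j'))"] that(3)
    by simp
  have col1: "T (i, j) < T (Suc i, j)" if "(i, j) \<in> \<nu>" "(Suc i, j) \<in> \<nu>" for i j
    using iff[OF that(1), of "T (Suc i, j)"] iff[OF that(2), of "Suc (T (Suc i, j))"]
      inter[of "T (Suc i, j)" i] by simp
  have col: "T (i, j) < T (i', j)" if "(i', j) \<in> \<nu>" "i < i'" for i i' j
    using that
  proof (induction i')
    case (Suc i')
    have m: "(i', j) \<in> \<nu>"
      using young_diagramD[OF \<nu> Suc.prems(1), of i' j] by simp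
    have "T (i', j) < T (Suc i', j)"
      using col1 m Suc.prems(1) by blast
    then show ?case
      using Suc.IH[OF m] Suc.prems(2) by (cases "i = i'") auto
  qed simp
  show ?thesis
    unfolding semistandard_tableaux_def using ext row col by blast
qed

text \<open>
  If \<open>g c\<close> is kept for all \<open>c \<noteq> Suc k\<close>, the values of \<open>g (Suc k) i\<close> permitted by monotonicity and
  interlacing form the interval from \<open>bk_low g k i\<close> to \<open>bk_high g k i\<close>. Row 0 has no row above
  it, so that only one upper bound remains there. \<open>bk_reflect\<close> reflects \<open>g (Suc k) i\<close> in this
  interval.
\<close>

definition bk_low :: "(nat \<Rightarrow> nat \<Rightarrow> nat) \<Rightarrow> nat \<Rightarrow> nat \<Rightarrow> nat" where
  "bk_low g k i = max (g (Suc (Suc k)) (Suc i)) (g k i)"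

definition bk_high :: "(nat \<Rightarrow> nat \<Rightarrow> nat) \<Rightarrow> nat \<Rightarrow> nat \<Rightarrow> nat" where
  "bk_high g k i =
     (case i of 0 \<Rightarrow> g (Suc (Suc k)) 0 | Suc i' \<Rightarrow> min (g (Suc (Suc k)) (Suc i')) (g k i'))"

definition bk_reflect :: "nat \<Rightarrow> (nat \<Rightarrow> nat \<Rightarrow> nat) \<Rightarrow> nat \<Rightarrow> nat \<Rightarrow> nat" where
  "bk_reflect k g = g(Suc k := (\<lambda>i. bk_low g k i + bk_high g k i - g (Suc k) i))"

text \<open>
  The Bender--Knuth involution for the entries \<open>k\<close> and \<open>Suc k\<close>: in each row the block of these
  entries is refilled so that the row counts become the reflected ones.
\<close>

definition bender_knuth :: "nat \<Rightarrow> box set \<Rightarrow> (box \<Rightarrow> nat) \<Rightarrow> box \<Rightarrow> nat" where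
  "bender_knuth k \<nu> T = (\<lambda>b\<in>\<nu>.
     if T b = k \<or> T b = Suc k
     then (if snd b < bk_reflect k (row_count \<nu> T) (Suc k) (fst b) then k else Suc k)
     else T b)"

lemma bk_bounds:
  assumes "young_diagram \<nu>" "T \<in> semistandard_tableaux \<nu>"
  shows "bk_low (row_count \<nu> T) k i \<le> row_count \<nu> T (Suc k) i"
    and "row_count \<nu> T (Suc k) i \<le> bk_high (row_count \<nu> T) k i"
proof -
  let ?g = "row_count \<nu> T"
  note mono = encodes_mono[OF encodes_row_count[OF assms]]
  have 1: "?g k i \<le> ?g (Suc k) i" "?g (Suc k) i \<le> ?g (Suc (Suc k)) i"
    by (rule mono; simp)+
  have 2: "?g (Suc (Suc k)) (Suc i) \<le> ?g (Suc k) i"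
    by (rule row_count_interlace[OF assms])
  have 3: "?g (Suc k) (Suc i') \<le> ?g k i'" for i'
    by (rule row_count_interlace[OF assms])
  show "bk_low ?g k i \<le> ?g (Suc k) i"
    unfolding bk_low_def using 1 2 by simp
  show "?g (Suc k) i \<le> bk_high ?g k i"
    unfolding bk_high_def using 1 3 by (cases i) simp_all
qed

lemma bk_reflect_bounds:
  assumes "young_diagram \<nu>" "T \<in> semistandard_tableaux \<nu>"
  shows "bk_low (row_count \<nu> T) k i \<le> bk_reflect k (row_count \<nu> T) (Suc k) i"
    and "bk_reflect k (row_count \<nu> T) (Suc k) i \<le> bk_high (row_count \<nu> T) k i"
  using bk_bounds[OF assms, of k i] by (simp_all add: bk_reflect_def)

lemma bk_reflect_interlace:
  assumes "young_diagram \<nu>" "T \<in> semistandard_tableaux \<nu>"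
  shows "bk_reflect k (row_count \<nu> T) (Suc c) (Suc i) \<le> bk_reflect k (row_count \<nu> T) c i"
proof -
  let ?g = "row_count \<nu> T"
  consider "c = k" | "c = Suc k" | "c \<noteq> k" "c \<noteq> Suc k" by blast
  then show ?thesis
  proof cases
    case 1
    have "bk_reflect k ?g (Suc k) (Suc i) \<le> ?g k i"
      using bk_reflect_bounds(2)[OF assms, of k "Suc i"] by (simp add: bk_high_def)
    with 1 show ?thesis by (simp add: bk_reflect_def)
  next
    case 2
    have "?g (Suc (Suc k)) (Suc i) \<le> bk_reflect k ?g (Suc k) i"
      using bk_reflect_bounds(1)[OF assms, of k i] by (simp add: bk_low_def)
    with 2 show ?thesis by (simp add: bk_reflect_def)
  next
    case 3
    then show ?thesis
      using row_count_interlace[OF assms, of c i] by (simp add: bk_reflect_def)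
  qed
qed

lemma encodes_bender_knuth:
  assumes "young_diagram \<nu>" "T \<in> semistandard_tableaux \<nu>"
  shows "encodes \<nu> (bender_knuth k \<nu> T) (bk_reflect k (row_count \<nu> T))"
  unfolding encodes_def
proof (intro allI)
  fix c i j
  let ?g = "row_count \<nu> T" and ?T' = "bender_knuth k \<nu> T"
  note enc = encodes_row_count[OF assms]
  have iff: "(i, j) \<in> \<nu> \<and> T (i, j) < c \<longleftrightarrow> j < ?g c i" for c
    by (rule encodesD[OF enc])
  show "(i, j) \<in> \<nu> \<and> ?T' (i, j) < c \<longleftrightarrow> j < bk_reflect k ?g c i"
  proof (cases "c = Suc k")
    case False
    then have "(i, j) \<in> \<nu> \<and> ?T' (i, j) < c \<longleftrightarrow> (i, j) \<in> \<nu> \<and> T (i, j) < c"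
      by (auto simp: bender_knuth_def)
    with False iff[of c] show ?thesis by (simp add: bk_reflect_def)
  next
    case True
    have "?g k i \<le> bk_reflect k ?g (Suc k) i"
      using bk_reflect_bounds(1)[OF assms, of k i] by (simp add: bk_low_def)
    moreover have "bk_reflect k ?g (Suc k) i \<le> ?g (Suc (Suc k)) i"
      using bk_reflect_bounds(2)[OF assms, of k i] by (simp add: bk_high_def split: nat.splits)
    ultimately have le: "j < ?g k i \<Longrightarrow> j < bk_reflect k ?g (Suc k) i"
        "j < bk_reflect k ?g (Suc k) i \<Longrightarrow> j < ?g (Suc (Suc k)) i"
      by linarith+
    show ?thesis
    proof (cases "(i, j) \<in> \<nu>")
      case False
      then show ?thesis using iff[of "Suc (Suc k)"] le(2) True by blast
    next
      case b: True
      consider "T (i, j) < k" | "T (i, j) = k \<or> T (i, j) = Suc k" | "Suc (Suc k) \<le> T (i, j)"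
        by linarith
      then show ?thesis
      proof cases
        case 1
        then have "?T' (i, j) < c"
          using b True by (simp add: bender_knuth_def)
        with 1 show ?thesis using b iff[of k] le(1) True by blast
      next
        case 2
        then have "?T' (i, j) = (if j < bk_reflect k ?g (Suc k) i then k else Suc k)"
          using b by (simp add: bender_knuth_def)
        then show ?thesis using b True by simp
      next
        case 3
        then have "\<not> ?T' (i, j) < c"
          using b True by (simp add: bender_knuth_def)
        moreover have "\<not> j < ?g (Suc (Suc k)) i"
          using 3 iff[of "Suc (Suc k)"] by simp
        ultimately show ?thesis using le(2) True by blast
      qed
    qed
  qed
qed

lemma bender_knuth_semistandard:
  assumes "young_diagram \<nu>" "T \<in> semistandard_tableaux \<nu>"
  shows "bender_knuth k \<nu> T \<in> semistandard_tableaux \<nu>"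
proof (rule semistandardI_encodes[OF assms(1) _ encodes_bender_knuth[OF assms]])
  show "bender_knuth k \<nu> T \<in> extensional \<nu>"
    by (simp add: bender_knuth_def)
qed (rule bk_reflect_interlace[OF assms])

lemma row_count_bender_knuth:
  assumes "young_diagram \<nu>" "T \<in> semistandard_tableaux \<nu>"
  shows "row_count \<nu> (bender_knuth k \<nu> T) = bk_reflect k (row_count \<nu> T)"
  by (rule encodes_imp_row_count[OF encodes_bender_knuth[OF assms]])

lemma bender_knuth_involution:
  assumes "young_diagram \<nu>" "T \<in> semistandard_tableaux \<nu>"
  shows "bender_knuth k \<nu> (bender_knuth k \<nu> T) = T"
proof (rule encodes_inj)
  let ?g = "row_count \<nu> T"
  note T' = bender_knuth_semistandard[OF assms, of k]
  have "bk_low (bk_reflect k ?g) k i = bk_low ?g k i" for i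
    by (simp add: bk_low_def bk_reflect_def)
  moreover have "bk_high (bk_reflect k ?g) k i = bk_high ?g k i" for i
    by (simp add: bk_high_def bk_reflect_def split: nat.split)
  ultimately have "bk_reflect k (bk_reflect k ?g) c i = ?g c i" for c i
    using bk_bounds[OF assms, of k i] by (simp add: bk_reflect_def[of k])
  then have "bk_reflect k (row_count \<nu> (bender_knuth k \<nu> T)) = ?g"
    by (simp add: row_count_bender_knuth[OF assms] fun_eq_iff)
  then show "encodes \<nu> (bender_knuth k \<nu> (bender_knuth k \<nu> T)) ?g"
    using encodes_bender_knuth[OF assms(1) T', of k] by simp
  show "encodes \<nu> T ?g"
    by (rule encodes_row_count[OF assms])
  show "T \<in> extensional \<nu>"
    using assms(2) by (simp add: semistandard_tableaux_def)
  show "bender_knuth k \<nu> (bender_knuth k \<nu> T) \<in> extensional \<nu>"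
    by (simp add: bender_knuth_def)
qed

lemma card_less_eq_sum_row_count:
  assumes "encodes \<nu> T g" "\<nu> \<subseteq> {..<N} \<times> UNIV"
  shows "card {b \<in> \<nu>. T b < c} = (\<Sum>i<N. g c i)"
proof -
  have "{b \<in> \<nu>. T b < c} = Sigma {..<N} (\<lambda>i. {..<g c i})"
    using assms unfolding encodes_def by fastforce
  then show ?thesis by simp
qed

text \<open>
  The lower end for row \<open>i\<close> and the upper end for row \<open>Suc i\<close> are the maximum and the minimum of
  the same two numbers. Therefore the reflection replaces the total of \<open>g (Suc k)\<close> by that of
  \<open>g k\<close> plus that of \<open>g (Suc (Suc k))\<close> minus itself, which exchanges the multiplicities of \<open>k\<close>
  and \<open>Suc k\<close>.
\<close>

lemma sum_bk_low_high:
  "(\<Sum>i<N. bk_low g k i + bk_high g k i) + bk_high g k N =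
   (\<Sum>i<N. g k i + g (Suc (Suc k)) i) + g (Suc (Suc k)) N"
proof (induction N)
  case 0
  then show ?case by (simp add: bk_high_def)
next
  case (Suc N)
  have "bk_low g k N + bk_high g k (Suc N) = g k N + g (Suc (Suc k)) (Suc N)"
    by (simp add: bk_low_def bk_high_def)
  with Suc show ?case by simp
qed

lemma card_less_bender_knuth:
  assumes "young_diagram \<nu>" "T \<in> semistandard_tableaux \<nu>"
  shows "card {b \<in> \<nu>. bender_knuth k \<nu> T b < Suc k} + card {b \<in> \<nu>. T b < Suc k} =
         card {b \<in> \<nu>. T b < k} + card {b \<in> \<nu>. T b < Suc (Suc k)}"
proof -
  let ?g = "row_count \<nu> T"
  have "finite (fst ` \<nu>)"
    using assms(1) young_diagram_finite by blast
  then obtain N where "fst ` \<nu> \<subseteq> {..<N}"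
    unfolding finite_nat_set_iff_bounded by blast
  then have N: "\<nu> \<subseteq> {..<N} \<times> UNIV" by force
  note enc = encodes_row_count[OF assms]
  have 0: "?g c N = 0" for c
  proof -
    have "{j. (N, j) \<in> \<nu> \<and> T (N, j) < c} = {}"
      using N by auto
    then show ?thesis by (simp only: row_count_def card.empty)
  qed
  have "bk_high ?g k N = 0"
    using 0[of "Suc (Suc k)"] by (cases N) (simp_all add: bk_high_def)
  then have "(\<Sum>i<N. bk_low ?g k i + bk_high ?g k i) = (\<Sum>i<N. ?g k i + ?g (Suc (Suc k)) i)"
    using sum_bk_low_high[of ?g k N] 0 by simp
  moreover have "bk_low ?g k i + bk_high ?g k i = bk_reflect k ?g (Suc k) i + ?g (Suc k) i" for i
    using bk_bounds[OF assms, of k i] by (simp add: bk_reflect_def)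
  ultimately show ?thesis
    by (simp add: card_less_eq_sum_row_count[OF enc N] sum.distrib
        card_less_eq_sum_row_count[OF encodes_bender_knuth[OF assms] N])
qed

lemma count_image_mset_tableau:
  assumes "finite \<nu>"
  shows "count (image_mset T (mset_set \<nu>)) c + card {b \<in> \<nu>. T b < c} = card {b \<in> \<nu>. T b < Suc c}"
proof -
  have "count (image_mset T (mset_set \<nu>)) c = card {b \<in> \<nu>. T b = c}"
  proof -
    have "count (image_mset T (mset_set \<nu>)) c = (\<Sum>b\<in>T -` {c} \<inter> \<nu>. count (mset_set \<nu>) b)"
      using assms by (simp add: count_image_mset)
    also have "\<dots> = (\<Sum>b\<in>T -` {c} \<inter> \<nu>. 1)"
      by (rule sum.cong) (use assms in auto)
    also have "\<dots> = card (T -` {c} \<inter> \<nu>)" by simp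
    also have "T -` {c} \<inter> \<nu> = {b \<in> \<nu>. T b = c}" by auto
    finally show ?thesis .
  qed
  moreover have "{b \<in> \<nu>. T b < Suc c} = {b \<in> \<nu>. T b = c} \<union> {b \<in> \<nu>. T b < c}"
    by auto
  moreover have "card ({b \<in> \<nu>. T b = c} \<union> {b \<in> \<nu>. T b < c}) =
      card {b \<in> \<nu>. T b = c} + card {b \<in> \<nu>. T b < c}"
    by (rule card_Un_disjoint) (use assms in auto)
  ultimately show ?thesis by simp
qed

lemma count_image_mset_transpose:
  "count (image_mset (transpose a b) m) c = count m (transpose a b c)"
proof (induction m)
  case (add x m)
  have "transpose a b x = c \<longleftrightarrow> x = transpose a b c"
    by (metis transpose_involutory)
  with add show ?case by simp
qed simp

lemma content_bender_knuth:
  assumes "young_diagram \<nu>" "T \<in> semistandard_tableaux \<nu>"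
  shows "image_mset (bender_knuth k \<nu> T) (mset_set \<nu>) =
         image_mset (transpose k (Suc k)) (image_mset T (mset_set \<nu>))"
proof (rule multiset_eqI, unfold count_image_mset_transpose)
  fix c
  let ?T' = "bender_knuth k \<nu> T"
  have fin: "finite \<nu>"
    by (rule young_diagram_finite[OF assms(1)])
  note cT = count_image_mset_tableau[OF fin, of T]
    and cT' = count_image_mset_tableau[OF fin, of ?T']
  have same: "{b \<in> \<nu>. ?T' b < c} = {b \<in> \<nu>. T b < c}" if "c \<noteq> Suc k" for c
    using that by (auto simp: bender_knuth_def)
  note mid = card_less_bender_knuth[OF assms, of k]
  consider "c = k" | "c = Suc k" | "c \<noteq> k" "c \<noteq> Suc k" by blast
  then show "count (image_mset ?T' (mset_set \<nu>)) c =
      count (image_mset T (mset_set \<nu>)) (transpose k (Suc k) c)"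
  proof cases
    case 1
    then show ?thesis
      using cT'[of k] cT[of "Suc k"] mid same[of k] by simp
  next
    case 2
    then show ?thesis
      using cT'[of "Suc k"] cT[of k] mid same[of "Suc (Suc k)"] by simp
  next
    case 3
    then show ?thesis
      using cT'[of c] cT[of c] same[of c] same[of "Suc c"] by simp
  qed
qed

text \<open>
  The coefficient function of the Schur function. Tableaux of given content are counted by
  \<open>card\<close>, which is 0 on infinite sets; no finiteness is needed, because all comparisons are made
  by bijections or by an explicit listing.
\<close>

definition schur_coeff :: "box set \<Rightarrow> nat multiset \<Rightarrow> complex" where
  "schur_coeff \<nu> m =
     of_nat (card {T \<in> semistandard_tableaux \<nu>. image_mset T (mset_set \<nu>) = m})"

lemma schur_coeff_transpose_Suc:
  assumes "young_diagram \<nu>"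
  shows "schur_coeff \<nu> (image_mset (transpose k (Suc k)) m) = schur_coeff \<nu> m"
proof -
  let ?S = "\<lambda>m. {T \<in> semistandard_tableaux \<nu>. image_mset T (mset_set \<nu>) = m}"
  let ?\<tau> = "image_mset (transpose k (Suc k))"
  have inv: "?\<tau> (?\<tau> m) = m"
    by (simp add: image_mset.compositionality)
  have maps: "bender_knuth k \<nu> T \<in> ?S (?\<tau> m)" if "T \<in> ?S m" for T m
    using that bender_knuth_semistandard[OF assms] content_bender_knuth[OF assms] by auto
  have "bij_betw (bender_knuth k \<nu>) (?S m) (?S (?\<tau> m))"
  proof (rule bij_betw_byWitness[where f' = "bender_knuth k \<nu>"])
    show "bender_knuth k \<nu> ` ?S m \<subseteq> ?S (?\<tau> m)"
      using maps by blast
    show "bender_knuth k \<nu> ` ?S (?\<tau> m) \<subseteq> ?S m"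
      using maps[of _ "?\<tau> m"] inv by auto
  qed (use bender_knuth_involution[OF assms] in auto)
  then show ?thesis
    unfolding schur_coeff_def by (simp add: bij_betw_same_card)
qed

lemma schur_coeff_transpose_less:
  assumes "young_diagram \<nu>"
  shows "schur_coeff \<nu> (image_mset (transpose a (a + Suc d)) m) = schur_coeff \<nu> m"
proof (induction d arbitrary: m)
  case 0
  then show ?case using schur_coeff_transpose_Suc[OF assms] by simp
next
  case (Suc d)
  let ?b = "a + Suc d"
  have "transpose a (Suc ?b) = transpose ?b (Suc ?b) \<circ> transpose a ?b \<circ> transpose ?b (Suc ?b)"
    by (auto simp: fun_eq_iff transpose_def)
  then have "image_mset (transpose a (a + Suc (Suc d))) m =
      image_mset (transpose ?b (Suc ?b)) (image_mset (transpose a ?b)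
        (image_mset (transpose ?b (Suc ?b)) m))"
    by (simp add: image_mset.compositionality comp_assoc)
  then show ?case
    by (simp only: schur_coeff_transpose_Suc[OF assms] Suc)
qed

lemma schur_coeff_transpose:
  assumes "young_diagram \<nu>"
  shows "schur_coeff \<nu> (image_mset (transpose a b) m) = schur_coeff \<nu> m"
proof -
  consider "a = b" | d where "b = a + Suc d" | d where "a = b + Suc d"
    by (metis less_imp_Suc_add linorder_neqE_nat add_Suc_right)
  then show ?thesis
    by cases (use schur_coeff_transpose_less[OF assms] in
      \<open>auto simp: transpose_commute simp del: add_Suc_right\<close>)
qed

lemma schur_coeff_permutation:
  assumes "young_diagram \<nu>" "permutation \<pi>"
  shows "schur_coeff \<nu> (image_mset \<pi> m) = schur_coeff \<nu> m"
proof -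
  obtain n where "swapidseq n \<pi>"
    using assms(2) by (auto simp: permutation_def)
  then show ?thesis
  proof (induction arbitrary: m rule: swapidseq.induct)
    case (comp_Suc n p a b)
    have "image_mset (transpose a b \<circ> p) m = image_mset (transpose a b) (image_mset p m)"
      by (simp add: image_mset.compositionality)
    then show ?case
      by (simp only: comp_Suc.IH schur_coeff_transpose[OF assms(1)])
  qed simp
qed

lemma coeff_schur:
  assumes "young_diagram \<nu>"
  shows "coeff_sym (schur \<nu>) = schur_coeff \<nu>"
proof -
  have "size m \<le> card \<nu>" if "schur_coeff \<nu> m \<noteq> 0" for m
  proof -
    have "{T \<in> semistandard_tableaux \<nu>. image_mset T (mset_set \<nu>) = m} \<noteq> {}"
      using that unfolding schur_coeff_def by (metis card.empty of_nat_0)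
    then show ?thesis by auto
  qed
  then show ?thesis
    unfolding schur_def schur_coeff_def[symmetric]
    by (intro Abs_sym_inverse) (use schur_coeff_permutation[OF assms] in blast)
qed

section \<open>Linear independence of Schur functions\<close>

lemma coeff_sym_sum: "coeff_sym (\<Sum>x\<in>A. f x) m = (\<Sum>x\<in>A. coeff_sym (f x) m)"
  by (induction A rule: infinite_finite_induct) (simp_all add: zero_sym.rep_eq plus_sym.rep_eq)

lemma le_semistandard:
  assumes "young_diagram \<nu>" "T \<in> semistandard_tableaux \<nu>" "b \<in> \<nu>"
  shows "fst b \<le> T b"
proof -
  have "i \<le> T (i, j)" if "(i, j) \<in> \<nu>" for i j
    using that
  proof (induction i)
    case (Suc i)
    have m: "(i, j) \<in> \<nu>"
      using young_diagramD[OF assms(1) Suc.prems, of i j] by simp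
    show ?case
      using Suc.IH[OF m] semistandard_colD[OF assms(2) m Suc.prems] by simp
  qed simp
  then show ?thesis
    using assms(3) by (cases b) auto
qed

text \<open>
  The monomial \<open>x\<^sup>\<nu>\<close>, in which the variable with index \<open>i\<close> has the length of row \<open>i\<close> as
  exponent.
\<close>

definition row_mset :: "box set \<Rightarrow> nat multiset" where
  "row_mset \<nu> = image_mset fst (mset_set \<nu>)"

lemma sum_mset_image: "sum_mset (image_mset f (mset_set A)) = sum f A"
  by (simp add: sum_unfold_sum_mset)

lemma row_mset_inj:
  assumes "young_diagram \<mu>" "young_diagram \<nu>" "row_mset \<mu> = row_mset \<nu>"
  shows "\<mu> = \<nu>"
proof -
  have "(i, j) \<in> \<nu> \<longleftrightarrow> j < count (row_mset \<nu>) i" if \<nu>: "young_diagram \<nu>" for \<nu> i j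
  proof -
    let ?A = "{j. (i, j) \<in> \<nu> \<and> True}"
    have fin: "finite \<nu>" by (rule young_diagram_finite[OF \<nu>])
    have "?A = {..<card ?A}"
      by (rule lower_set_eq_lessThan[OF finite_row[OF fin]])
        (use young_diagramD[OF \<nu>, of i _ i] in auto)
    then have "j \<in> ?A \<longleftrightarrow> j \<in> {..<card ?A}"
      by (rule arg_cong[where f = "\<lambda>A. j \<in> A"])
    moreover have "count (row_mset \<nu>) i = card ?A"
    proof -
      have "count (row_mset \<nu>) i = (\<Sum>b\<in>fst -` {i} \<inter> \<nu>. count (mset_set \<nu>) b)"
        using fin by (simp add: row_mset_def count_image_mset)
      also have "\<dots> = (\<Sum>b\<in>fst -` {i} \<inter> \<nu>. 1)"
        by (rule sum.cong) (use fin in auto)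
      also have "\<dots> = card (fst -` {i} \<inter> \<nu>)" by simp
      also have "fst -` {i} \<inter> \<nu> = Pair i ` ?A" by force
      also have "card \<dots> = card ?A" by (rule card_image) (simp add: inj_on_def)
      finally show ?thesis .
    qed
    ultimately show ?thesis by simp
  qed
  from this[OF assms(1)] this[OF assms(2)] assms(3) show ?thesis
    by (simp add: set_eq_iff)
qed

lemma semistandard_row_content:
  assumes \<nu>: "young_diagram \<nu>" and T: "T \<in> semistandard_tableaux \<nu>"
    and content: "image_mset T (mset_set \<nu>) = row_mset \<mu>"
  shows "sum fst \<nu> \<le> sum fst \<mu>"
    and "sum fst \<nu> = sum fst \<mu> \<Longrightarrow> young_diagram \<mu> \<Longrightarrow> \<nu> = \<mu>"
proof -
  have sum_T: "sum T \<nu> = sum fst \<mu>"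
    using arg_cong[OF content, of sum_mset] by (simp only: row_mset_def sum_mset_image)
  have le: "fst b \<le> T b" if "b \<in> \<nu>" for b
    by (rule le_semistandard[OF \<nu> T that])
  then have "sum fst \<nu> \<le> sum T \<nu>"
    by (rule sum_mono)
  then show "sum fst \<nu> \<le> sum fst \<mu>"
    by (simp only: sum_T)
  assume eq: "sum fst \<nu> = sum fst \<mu>" and \<mu>: "young_diagram \<mu>"
  have fin: "finite \<nu>" by (rule young_diagram_finite[OF \<nu>])
  have "fst b = T b" if "b \<in> \<nu>" for b
    by (rule sum_mono_inv[of fst \<nu> T]) (use eq sum_T le that fin in auto)
  then have "image_mset T (mset_set \<nu>) = row_mset \<nu>"
    unfolding row_mset_def by (intro image_mset_cong) (use fin in auto)
  with content show "\<nu> = \<mu>"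
    using row_mset_inj[OF \<nu> \<mu>] by simp
qed

text \<open>
  The Kostka numbers form a unitriangular matrix for the ordering of diagrams by
  \<open>sum fst\<close>, the sum of the row indices of the boxes.
\<close>

lemma schur_coeff_row_mset_self:
  assumes "young_diagram \<nu>"
  shows "schur_coeff \<nu> (row_mset \<nu>) = 1"
proof -
  have fin: "finite \<nu>" by (rule young_diagram_finite[OF assms])
  have "{T \<in> semistandard_tableaux \<nu>. image_mset T (mset_set \<nu>) = row_mset \<nu>} = {restrict fst \<nu>}"
  proof (intro equalityI subsetI)
    fix T assume "T \<in> {T \<in> semistandard_tableaux \<nu>. image_mset T (mset_set \<nu>) = row_mset \<nu>}"
    then have T: "T \<in> semistandard_tableaux \<nu>" and c: "image_mset T (mset_set \<nu>) = row_mset \<nu>"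
      by auto
    have "sum T \<nu> = sum fst \<nu>"
      using arg_cong[OF c, of sum_mset] by (simp only: row_mset_def sum_mset_image)
    then have "fst b = T b" if "b \<in> \<nu>" for b
      by (intro sum_mono_inv[of fst \<nu> T]) (use le_semistandard[OF assms T] that fin in auto)
    then have "T = restrict fst \<nu>"
      using T by (intro extensionalityI[of T \<nu>]) (auto simp: semistandard_tableaux_def)
    then show "T \<in> {restrict fst \<nu>}" by simp
  next
    fix T assume "T \<in> {restrict fst \<nu>}"
    then have T: "T = restrict fst \<nu>" by simp
    have "image_mset T (mset_set \<nu>) = row_mset \<nu>"
      unfolding row_mset_def T by (intro image_mset_cong) (use fin in auto)
    then show "T \<in> {T \<in> semistandard_tableaux \<nu>. image_mset T (mset_set \<nu>) = row_mset \<nu>}"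
      by (auto simp: T semistandard_tableaux_def)
  qed
  then show ?thesis by (simp add: schur_coeff_def)
qed

lemma schur_coeff_row_mset_eq_0:
  assumes "young_diagram \<nu>" "young_diagram \<mu>" "\<nu> \<noteq> \<mu>" "sum fst \<mu> \<le> sum fst \<nu>"
  shows "schur_coeff \<nu> (row_mset \<mu>) = 0"
proof -
  have "{T \<in> semistandard_tableaux \<nu>. image_mset T (mset_set \<nu>) = row_mset \<mu>} = {}"
    using semistandard_row_content[OF assms(1), of _ \<mu>] assms(2-4) by fastforce
  then show ?thesis by (simp only: schur_coeff_def card.empty of_nat_0)
qed

lemma schur_sum_eq_0D:
  assumes fin: "finite A" and young: "\<And>\<mu>. \<mu> \<in> A \<Longrightarrow> young_diagram \<mu>"
    and sum0: "(\<Sum>\<mu>\<in>A. a \<mu> *\<^sub>S schur \<mu>) = 0" and "\<nu> \<in> A"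
  shows "a \<nu> = 0"
proof (rule ccontr)
  assume "a \<nu> \<noteq> 0"
  let ?B = "{\<mu> \<in> A. a \<mu> \<noteq> 0}"
  have B: "finite ?B" "?B \<noteq> {}"
    using fin \<open>a \<nu> \<noteq> 0\<close> \<open>\<nu> \<in> A\<close> by auto
  \<comment> \<open>By triangularity, at the monomial of a minimal \<open>\<mu>\<close> only \<open>S\<^sub>\<mu>\<close> contributes.\<close>
  define \<mu> where "\<mu> = arg_min_on (sum fst) ?B"
  have \<mu>: "\<mu> \<in> ?B"
    unfolding \<mu>_def by (rule arg_min_if_finite(1)[OF B])
  have min: "sum fst \<mu> \<le> sum fst \<kappa>" if "\<kappa> \<in> ?B" for \<kappa>
    unfolding \<mu>_def by (rule arg_min_least[OF B that])
  have "0 = coeff_sym (\<Sum>\<kappa>\<in>A. a \<kappa> *\<^sub>S schur \<kappa>) (row_mset \<mu>)"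
    by (simp add: sum0 zero_sym.rep_eq)
  also have "\<dots> = (\<Sum>\<kappa>\<in>A. a \<kappa> * schur_coeff \<kappa> (row_mset \<mu>))"
    using young by (simp add: coeff_sym_sum scale_sym.rep_eq coeff_schur)
  also have "\<dots> = (\<Sum>\<kappa>\<in>A. if \<kappa> = \<mu> then a \<mu> else 0)"
  proof (rule sum.cong[OF refl])
    fix \<kappa> assume \<kappa>: "\<kappa> \<in> A"
    show "a \<kappa> * schur_coeff \<kappa> (row_mset \<mu>) = (if \<kappa> = \<mu> then a \<mu> else 0)"
    proof (cases "\<kappa> = \<mu> \<or> a \<kappa> = 0")
      case True
      then show ?thesis
        using schur_coeff_row_mset_self[of \<mu>] young \<mu> by auto
    next
      case False
      then show ?thesis
        using schur_coeff_row_mset_eq_0[of \<kappa> \<mu>] young \<mu> \<kappa> min by auto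
    qed
  qed
  also have "\<dots> = a \<mu>"
    using fin \<mu> by simp
  finally show False
    using \<mu> by simp
qed

lemma inj_on_schur: "inj_on schur (Collect young_diagram)"
proof (rule inj_onI, rule ccontr)
  fix \<mu> \<nu> assume \<mu>\<nu>: "\<mu> \<in> Collect young_diagram" "\<nu> \<in> Collect young_diagram"
    and eq: "schur \<mu> = schur \<nu>" and ne: "\<mu> \<noteq> \<nu>"
  let ?a = "\<lambda>\<kappa>. if \<kappa> = \<mu> then 1 else - 1 :: complex"
  have "(\<Sum>\<kappa>\<in>{\<mu>, \<nu>}. ?a \<kappa> *\<^sub>S schur \<kappa>) = 0"
    using ne eq by simp
  then have "?a \<mu> = 0"
    by (rule schur_sum_eq_0D[rotated 2]) (use \<mu>\<nu> in auto)
  then show False by simp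
qed

lemma independent_schur: "sym.independent (schur ` Collect young_diagram)"
  unfolding sym.independent_explicit_module
proof (intro allI impI)
  fix S u v
  assume S: "finite S" "S \<subseteq> schur ` Collect young_diagram"
    and sum0: "(\<Sum>v\<in>S. u v *\<^sub>S v) = 0" and v: "v \<in> S"
  obtain A where A: "A \<subseteq> Collect young_diagram" "S = schur ` A"
    using S(2) by (meson subset_imageE)
  have inj: "inj_on schur A"
    by (rule inj_on_subset[OF inj_on_schur A(1)])
  have "finite A"
    using S(1) inj A(2) by (simp add: finite_image_iff)
  moreover have "(\<Sum>\<mu>\<in>A. u (schur \<mu>) *\<^sub>S schur \<mu>) = 0"
    using sum0 inj A(2) by (simp add: sum.reindex)
  moreover obtain \<mu> where "\<mu> \<in> A" "v = schur \<mu>"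
    using v A(2) by blast
  ultimately show "u v = 0"
    using schur_sum_eq_0D[of A "u \<circ> schur" \<mu>] A(1) by auto
qed

lemma laguerre_op_schur:
  assumes "young_diagram \<nu>"
  shows "laguerre_op z z' (schur \<nu>) = laguerre_op_schur z z' \<nu>"
  unfolding laguerre_op_def
  using assms by (subst sym.construct_basis[OF independent_schur])
    (simp_all add: the_inv_into_f_f[OF inj_on_schur])

lemma laguerre_op_sum:
  "laguerre_op z z' (\<Sum>\<mu>\<in>A. a \<mu> *\<^sub>S f \<mu>) = (\<Sum>\<mu>\<in>A. a \<mu> *\<^sub>S laguerre_op z z' (f \<mu>))"
proof -
  interpret op: Vector_Spaces.linear scale_sym scale_sym "laguerre_op z z'"
    unfolding laguerre_op_def by (rule sym.linear_construct[OF independent_schur])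
  show ?thesis
    by (simp add: op.sum op.scale)
qed

section \<open>Removing the smallest entry of a standard tableau\<close>

text \<open>The boxes of \<open>\<nu>\<close> whose addition to \<open>\<kappa>\<close> gives a Young diagram.\<close>

definition addable :: "box set \<Rightarrow> box set \<Rightarrow> box set" where
  "addable \<nu> \<kappa> = {b \<in> \<nu> - \<kappa>. young_diagram (insert b \<kappa>)}"

lemma standard_tableauxI:
  assumes "T \<in> extensional \<theta>" "bij_betw T \<theta> {1..card \<theta>}"
    and "\<And>i j j'. (i, j) \<in> \<theta> \<Longrightarrow> (i, j') \<in> \<theta> \<Longrightarrow> j < j' \<Longrightarrow> T (i, j) < T (i, j')"
    and "\<And>i i' j. (i, j) \<in> \<theta> \<Longrightarrow> (i', j) \<in> \<theta> \<Longrightarrow> i < i' \<Longrightarrow> T (i, j) < T (i', j)"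
  shows "T \<in> standard_tableaux \<theta>"
  using assms unfolding standard_tableaux_def by blast

lemma standard_tableauxD:
  assumes "T \<in> standard_tableaux \<theta>"
  shows "T \<in> extensional \<theta>" "bij_betw T \<theta> {1..card \<theta>}"
    and "\<And>i j j'. (i, j) \<in> \<theta> \<Longrightarrow> (i, j') \<in> \<theta> \<Longrightarrow> j < j' \<Longrightarrow> T (i, j) < T (i, j')"
    and "\<And>i i' j. (i, j) \<in> \<theta> \<Longrightarrow> (i', j) \<in> \<theta> \<Longrightarrow> i < i' \<Longrightarrow> T (i, j) < T (i', j)"
  using assms unfolding standard_tableaux_def by blast+

lemma finite_standard_tableaux:
  assumes "finite \<theta>"
  shows "finite (standard_tableaux \<theta>)"
proof (rule finite_subset)
  show "standard_tableaux \<theta> \<subseteq> (\<Pi>\<^sub>E b\<in>\<theta>. {1..card \<theta>})"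
    by (auto simp: PiE_def dest: standard_tableauxD(1) bij_betwE[OF standard_tableauxD(2)])
  show "finite (\<Pi>\<^sub>E b\<in>\<theta>. {1..card \<theta>})"
    using assms by (intro finite_PiE) auto
qed

lemma skew_dim_self: "skew_dim \<nu> \<nu> = 1"
proof -
  have "standard_tableaux {} = {\<lambda>_. undefined}"
    by (auto simp: standard_tableaux_def bij_betw_def)
  then show ?thesis by (simp add: skew_dim_def)
qed

lemma smallest_entry_addable:
  assumes \<nu>: "young_diagram \<nu>" and \<kappa>: "young_diagram \<kappa>" "\<kappa> \<subseteq> \<nu>"
    and T: "T \<in> standard_tableaux (\<nu> - \<kappa>)" and b: "b \<in> \<nu> - \<kappa>" "T b = 1"
  shows "b \<in> addable \<nu> \<kappa>"
proof -
  obtain i j where b_eq: "b = (i, j)" by (cases b)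
  \<comment> \<open>A box of \<open>\<nu>/\<kappa>\<close> weakly above and to the left of \<open>b\<close> has an entry at most 1; compare through
      the box \<open>(i', j)\<close>, which lies in \<open>\<nu>/\<kappa>\<close> as well.\<close>
  have "(i', j') \<in> insert b \<kappa>" if le: "i' \<le> i" "j' \<le> j" for i' j'
  proof (rule ccontr)
    assume n: "(i', j') \<notin> insert b \<kappa>"
    have 1: "(i', j') \<in> \<nu> - \<kappa>"
      using n young_diagramD[OF \<nu>, of i j i' j'] b le b_eq by auto
    have 2: "(i', j) \<in> \<nu> - \<kappa>"
      using young_diagramD[OF \<nu>, of i j i' j] young_diagramD[OF \<kappa>(1), of i' j i' j'] 1 b le b_eq
      by auto
    have "T (i', j') \<le> T (i', j)"
      using standard_tableauxD(3)[OF T 1 2] le by (cases "j' = j") auto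
    moreover have "T (i', j) \<le> T (i, j)"
      using standard_tableauxD(4)[OF T 2, of i] le b b_eq by (cases "i' = i") auto
    moreover have "T (i', j') \<ge> 1"
      using bij_betwE[OF standard_tableauxD(2)[OF T]] 1 by auto
    ultimately have "T (i', j') = T b"
      using b b_eq by simp
    then have "(i', j') = b"
      using bij_betw_imp_inj_on[OF standard_tableauxD(2)[OF T]] 1 b(1) by (meson inj_onD)
    then show False using n by simp
  qed
  moreover have "(i', j') \<in> insert b \<kappa>" if "(i1, j1) \<in> \<kappa>" "i' \<le> i1" "j' \<le> j1" for i1 j1 i' j'
    using young_diagramD[OF \<kappa>(1) that] by simp
  ultimately have "young_diagram (insert b \<kappa>)"
    using young_diagram_finite[OF \<kappa>(1)] b_eq unfolding young_diagram_def by blast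
  then show ?thesis using b by (simp add: addable_def)
qed

lemma bij_betw_Suc_shift:
  assumes "finite \<theta>" "b \<in> \<theta>" "bij_betw U (\<theta> - {b}) {1..card (\<theta> - {b})}"
  shows "bij_betw (\<lambda>x\<in>\<theta>. if x = b then 1 else Suc (U x)) \<theta> {1..card \<theta>}"
proof -
  let ?T = "\<lambda>x\<in>\<theta>. if x = b then 1 else Suc (U x)"
  have c: "card \<theta> = Suc (card (\<theta> - {b}))"
    using assms(1,2) by (metis card.remove)
  have pos: "0 < U x" if "x \<in> \<theta>" "x \<noteq> b" for x
  proof -
    have "U x \<in> {1..card (\<theta> - {b})}"
      using bij_betwE[OF assms(3)] that by blast
    then show ?thesis by simp
  qed
  have "inj_on ?T \<theta>"
    using bij_betw_imp_inj_on[OF assms(3)] by (auto simp: inj_on_def dest: pos)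
  moreover have "?T ` \<theta> = {1..card \<theta>}"
  proof -
    have "?T ` \<theta> = insert 1 (Suc ` U ` (\<theta> - {b}))"
      using assms(2) by force
    also have "U ` (\<theta> - {b}) = {1..card (\<theta> - {b})}"
      by (rule bij_betw_imp_surj_on[OF assms(3)])
    also have "insert 1 (Suc ` {1..card (\<theta> - {b})}) = {1..card \<theta>}"
      unfolding c by (simp only: image_Suc_atLeastAtMost) auto
    finally show ?thesis .
  qed
  ultimately show ?thesis by (simp add: bij_betw_def)
qed

lemma bij_betw_pred_shift:
  assumes "finite \<theta>" "b \<in> \<theta>" "bij_betw T \<theta> {1..card \<theta>}" "T b = 1"
  shows "bij_betw (\<lambda>x\<in>\<theta> - {b}. T x - 1) (\<theta> - {b}) {1..card (\<theta> - {b})}"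
proof -
  have c: "card \<theta> = Suc (card (\<theta> - {b}))"
    using assms(1,2) by (metis card.remove)
  have "bij_betw T (\<theta> - {b}) ({1..card \<theta>} - {1})"
    using assms(2-4) by (metis bij_betw_DiffI bij_betw_singletonI empty_subsetI insert_subset
      singletonI bij_betwE)
  moreover have "bij_betw (\<lambda>n. n - 1) ({1..card \<theta>} - {1}) {1..card (\<theta> - {b})}"
    by (rule bij_betw_byWitness[where f' = Suc]) (auto simp: c)
  ultimately have "bij_betw ((\<lambda>n. n - 1) \<circ> T) (\<theta> - {b}) {1..card (\<theta> - {b})}"
    by (rule bij_betw_trans)
  then show ?thesis
    by (rule bij_betw_cong[THEN iffD1, rotated]) simp
qed

lemma card_standard_tableaux_smallest:
  assumes \<kappa>: "young_diagram \<kappa>" and fin: "finite \<nu>" and b: "b \<in> addable \<nu> \<kappa>"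
  shows "card {T \<in> standard_tableaux (\<nu> - \<kappa>). T b = 1} = skew_dim \<nu> (insert b \<kappa>)"
proof -
  let ?\<theta> = "\<nu> - \<kappa>"
  have fin\<theta>: "finite ?\<theta>" and b\<theta>: "b \<in> ?\<theta>" and yb: "young_diagram (insert b \<kappa>)"
    using fin b by (auto simp: addable_def)
  have eq: "\<nu> - insert b \<kappa> = ?\<theta> - {b}" by auto
  have minimal: "x = b" if "x \<in> ?\<theta>" "fst x \<le> fst b" "snd x \<le> snd b" for x
    using young_diagramD[OF yb, of "fst b" "snd b" "fst x" "snd x"] that by auto
  let ?f = "\<lambda>T. \<lambda>x\<in>?\<theta> - {b}. T x - 1 :: nat"
  let ?g = "\<lambda>U. \<lambda>x\<in>?\<theta>. if x = b then 1 else Suc (U x)"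
  have "bij_betw ?f {T \<in> standard_tableaux ?\<theta>. T b = 1} (standard_tableaux (?\<theta> - {b}))"
  proof (rule bij_betw_byWitness[where f' = ?g])
    show "\<forall>T\<in>{T \<in> standard_tableaux ?\<theta>. T b = 1}. ?g (?f T) = T"
    proof
      fix T assume "T \<in> {T \<in> standard_tableaux ?\<theta>. T b = 1}"
      then have T: "T \<in> standard_tableaux ?\<theta>" and Tb: "T b = 1" by auto
      have "Suc (T x - 1) = T x" if "x \<in> ?\<theta>" for x
      proof -
        have "T x \<in> {1..card ?\<theta>}"
          using bij_betwE[OF standard_tableauxD(2)[OF T]] that by blast
        then show ?thesis by simp
      qed
      then show "?g (?f T) = T"
        by (intro extensionalityI[of _ ?\<theta>] standard_tableauxD(1)[OF T]) (auto simp: Tb)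
    qed
    show "\<forall>U\<in>standard_tableaux (?\<theta> - {b}). ?f (?g U) = U"
    proof
      fix U assume U: "U \<in> standard_tableaux (?\<theta> - {b})"
      show "?f (?g U) = U"
        by (rule extensionalityI[of _ "?\<theta> - {b}"]) (simp_all add: standard_tableauxD(1)[OF U])
    qed
    show "?f ` {T \<in> standard_tableaux ?\<theta>. T b = 1} \<subseteq> standard_tableaux (?\<theta> - {b})"
    proof safe
      fix T assume T: "T \<in> standard_tableaux ?\<theta>" and Tb: "T b = 1"
      have pos: "T x \<ge> 1" if "x \<in> ?\<theta>" for x
        using bij_betwE[OF standard_tableauxD(2)[OF T]] that by auto
      show "?f T \<in> standard_tableaux (?\<theta> - {b})"
      proof (rule standard_tableauxI)
        show "bij_betw (?f T) (?\<theta> - {b}) {1..card (?\<theta> - {b})}"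
          by (rule bij_betw_pred_shift[OF fin\<theta> b\<theta> standard_tableauxD(2)[OF T] Tb])
      next
        fix i j j' assume *: "(i, j) \<in> ?\<theta> - {b}" "(i, j') \<in> ?\<theta> - {b}" "j < j'"
        then show "?f T (i, j) < ?f T (i, j')"
          using standard_tableauxD(3)[OF T, of i j j'] pos[of "(i, j)"] by simp
      next
        fix i i' j assume *: "(i, j) \<in> ?\<theta> - {b}" "(i', j) \<in> ?\<theta> - {b}" "i < i'"
        then show "?f T (i, j) < ?f T (i', j)"
          using standard_tableauxD(4)[OF T, of i j i'] pos[of "(i, j)"] by simp
      qed simp
    qed
    show "?g ` standard_tableaux (?\<theta> - {b}) \<subseteq> {T \<in> standard_tableaux ?\<theta>. T b = 1}"
    proof safe
      fix U assume U: "U \<in> standard_tableaux (?\<theta> - {b})"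
      have pos: "U x \<ge> 1" if "x \<in> ?\<theta>" "x \<noteq> b" for x
        using bij_betwE[OF standard_tableauxD(2)[OF U]] that by auto
      show "?g U b = 1" using b\<theta> by simp
      show "?g U \<in> standard_tableaux ?\<theta>"
      proof (rule standard_tableauxI)
        show "bij_betw (?g U) ?\<theta> {1..card ?\<theta>}"
          by (rule bij_betw_Suc_shift[OF fin\<theta> b\<theta> standard_tableauxD(2)[OF U]])
      next
        fix i j j' assume *: "(i, j) \<in> ?\<theta>" "(i, j') \<in> ?\<theta>" "j < j'"
        then have "(i, j') \<noteq> b"
          using minimal[of "(i, j)"] by auto
        with * show "?g U (i, j) < ?g U (i, j')"
          using standard_tableauxD(3)[OF U, of i j j'] pos[of "(i, j')"] by auto
      next
        fix i i' j assume *: "(i, j) \<in> ?\<theta>" "(i', j) \<in> ?\<theta>" "i < i'"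
        then have "(i', j) \<noteq> b"
          using minimal[of "(i, j)"] by auto
        with * show "?g U (i, j) < ?g U (i', j)"
          using standard_tableauxD(4)[OF U, of i j i'] pos[of "(i', j)"] by auto
      qed simp
    qed
  qed
  then show ?thesis
    by (simp only: skew_dim_def eq bij_betw_same_card)
qed

lemma skew_dim_recursion:
  assumes \<nu>: "young_diagram \<nu>" and \<kappa>: "young_diagram \<kappa>" "\<kappa> \<subset> \<nu>"
  shows "skew_dim \<nu> \<kappa> = (\<Sum>b\<in>addable \<nu> \<kappa>. skew_dim \<nu> (insert b \<kappa>))"
proof -
  let ?\<theta> = "\<nu> - \<kappa>"
  let ?S = "\<lambda>b. {T \<in> standard_tableaux ?\<theta>. T b = 1}"
  have fin: "finite \<nu>" by (rule young_diagram_finite[OF \<nu>])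
  have sub: "addable \<nu> \<kappa> \<subseteq> ?\<theta>" by (auto simp: addable_def)
  have finA: "finite (addable \<nu> \<kappa>)"
    by (rule finite_subset[OF sub]) (use fin in simp)
  have "standard_tableaux ?\<theta> \<subseteq> (\<Union>b\<in>addable \<nu> \<kappa>. ?S b)"
  proof
    fix T assume T: "T \<in> standard_tableaux ?\<theta>"
    have "card ?\<theta> \<noteq> 0" using \<kappa>(2) fin by auto
    then have "1 \<in> {1..card ?\<theta>}" by simp
    then obtain b where "b \<in> ?\<theta>" "T b = 1"
      using bij_betw_imp_surj_on[OF standard_tableauxD(2)[OF T]] by (metis imageE)
    with T show "T \<in> (\<Union>b\<in>addable \<nu> \<kappa>. ?S b)"
      using smallest_entry_addable[OF \<nu> \<kappa>(1) _ T] \<kappa>(2) by blast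
  qed
  then have "standard_tableaux ?\<theta> = (\<Union>b\<in>addable \<nu> \<kappa>. ?S b)" by blast
  then have "skew_dim \<nu> \<kappa> = card (\<Union>b\<in>addable \<nu> \<kappa>. ?S b)"
    by (simp only: skew_dim_def)
  also have "\<dots> = (\<Sum>b\<in>addable \<nu> \<kappa>. card (?S b))"
  proof (rule card_UN_disjoint[OF finA])
    show "\<forall>b\<in>addable \<nu> \<kappa>. finite (?S b)"
      using finite_standard_tableaux[of ?\<theta>] fin by simp
    show "\<forall>b\<in>addable \<nu> \<kappa>. \<forall>b'\<in>addable \<nu> \<kappa>. b \<noteq> b' \<longrightarrow> ?S b \<inter> ?S b' = {}"
    proof (intro ballI impI equals0I)
      fix b b' T
      assume "b \<in> addable \<nu> \<kappa>" "b' \<in> addable \<nu> \<kappa>" "b \<noteq> b'" and T: "T \<in> ?S b \<inter> ?S b'"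
      moreover have "inj_on T ?\<theta>"
        using T bij_betw_imp_inj_on[OF standard_tableauxD(2)] by blast
      moreover have "T b = T b'" using T by simp
      ultimately show False using sub by (meson inj_onD subsetD)
    qed
  qed
  also have "\<dots> = (\<Sum>b\<in>addable \<nu> \<kappa>. skew_dim \<nu> (insert b \<kappa>))"
    by (rule sum.cong[OF refl]) (rule card_standard_tableaux_smallest[OF \<kappa>(1) fin])
  finally show ?thesis .
qed

section \<open>The eigenvector equation\<close>

text \<open>The coefficient of the Schur function of \<open>\<mu>\<close> in the Laguerre symmetric function of \<open>\<nu>\<close>.\<close>

definition laguerre_coeff :: "complex \<Rightarrow> complex \<Rightarrow> box set \<Rightarrow> box set \<Rightarrow> complex" where
  "laguerre_coeff z z' \<nu> \<mu> =
     (- 1) ^ (card \<nu> - card \<mu>) * of_nat (skew_dim \<nu> \<mu>) / fact (card \<nu> - card \<mu>)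
       * skew_poch z \<nu> \<mu> * skew_poch z' \<nu> \<mu>"

text \<open>The factor with which the Laguerre operator removes the box \<open>b\<close>.\<close>

definition box_weight :: "complex \<Rightarrow> complex \<Rightarrow> box \<Rightarrow> complex" where
  "box_weight z z' b = (z + of_int (content b)) * (z' + of_int (content b))"

lemma skew_poch_insert:
  assumes "finite \<nu>" "b \<in> \<nu> - \<kappa>"
  shows "skew_poch z \<nu> \<kappa> = (z + of_int (content b)) * skew_poch z \<nu> (insert b \<kappa>)"
proof -
  have "\<nu> - insert b \<kappa> = (\<nu> - \<kappa>) - {b}" by auto
  then show ?thesis
    unfolding skew_poch_def using assms by (simp add: prod.remove)
qed

lemma laguerre_coeff_recursion:
  assumes \<nu>: "young_diagram \<nu>" and \<kappa>: "young_diagram \<kappa>" "\<kappa> \<subseteq> \<nu>"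
  shows "(\<Sum>b\<in>addable \<nu> \<kappa>. laguerre_coeff z z' \<nu> (insert b \<kappa>) * box_weight z z' b) =
         (of_nat (card \<kappa>) - of_nat (card \<nu>)) * laguerre_coeff z z' \<nu> \<kappa>"
proof (cases "\<kappa> = \<nu>")
  case True
  then show ?thesis by (simp add: addable_def)
next
  case False
  have fin: "finite \<nu>" by (rule young_diagram_finite[OF \<nu>])
  have fin\<kappa>: "finite \<kappa>" by (rule young_diagram_finite[OF \<kappa>(1)])
  have "card \<kappa> < card \<nu>"
    using False \<kappa>(2) fin by (simp add: psubset_card_mono psubset_eq)
  then obtain d where d: "card \<nu> = card \<kappa> + Suc d"
    using less_imp_Suc_add by auto
  let ?P = "skew_poch z \<nu> \<kappa> * skew_poch z' \<nu> \<kappa>"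
  have "laguerre_coeff z z' \<nu> (insert b \<kappa>) * box_weight z z' b =
      (- 1) ^ d / fact d * ?P * of_nat (skew_dim \<nu> (insert b \<kappa>))" if b: "b \<in> addable \<nu> \<kappa>" for b
  proof -
    have b': "b \<in> \<nu> - \<kappa>" using b by (simp add: addable_def)
    have "card \<nu> - card (insert b \<kappa>) = d"
      using b' fin\<kappa> d by simp
    then show ?thesis
      by (simp add: laguerre_coeff_def box_weight_def skew_poch_insert[OF fin b'])
  qed
  then have "(\<Sum>b\<in>addable \<nu> \<kappa>. laguerre_coeff z z' \<nu> (insert b \<kappa>) * box_weight z z' b) =
      (- 1) ^ d / fact d * ?P * (\<Sum>b\<in>addable \<nu> \<kappa>. of_nat (skew_dim \<nu> (insert b \<kappa>)))"
    by (simp add: sum_distrib_left)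
  also have "(\<Sum>b\<in>addable \<nu> \<kappa>. of_nat (skew_dim \<nu> (insert b \<kappa>))) = (of_nat (skew_dim \<nu> \<kappa>) :: complex)"
    using skew_dim_recursion[OF \<nu> \<kappa>(1)] False \<kappa>(2) by auto
  also have "(- 1) ^ d / fact d * ?P * of_nat (skew_dim \<nu> \<kappa>) =
      (of_nat (card \<kappa>) - of_nat (card \<nu>)) * laguerre_coeff z z' \<nu> \<kappa>"
  proof -
    have "1 + of_nat d \<noteq> (0 :: complex)"
      by (metis of_nat_Suc of_nat_eq_0_iff nat.distinct(1))
    then show ?thesis
      by (simp add: laguerre_coeff_def d divide_simps) (simp add: algebra_simps)
  qed
  finally show ?thesis .
qed

lemma laguerre_sym_eq:
  "laguerre_sym z z' \<nu> = (\<Sum>\<mu> | young_diagram \<mu> \<and> \<mu> \<subseteq> \<nu>. laguerre_coeff z z' \<nu> \<mu> *\<^sub>S schur \<mu>)"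
  by (simp add: laguerre_sym_def laguerre_coeff_def)

lemma finite_subdiagrams: "finite \<nu> \<Longrightarrow> finite {\<mu>. young_diagram \<mu> \<and> \<mu> \<subseteq> \<nu>}"
  by (rule finite_subset[of _ "Pow \<nu>"]) auto

lemma laguerre_sym_nonzero:
  assumes "young_diagram \<nu>"
  shows "laguerre_sym z z' \<nu> \<noteq> 0"
proof
  assume "laguerre_sym z z' \<nu> = 0"
  then have "laguerre_coeff z z' \<nu> \<nu> = 0"
    unfolding laguerre_sym_eq
    by (rule schur_sum_eq_0D[rotated 2])
      (use assms finite_subdiagrams[OF young_diagram_finite[OF assms]] in auto)
  then show False
    by (simp add: laguerre_coeff_def skew_dim_self skew_poch_def)
qed

text \<open>
  Pairs of a subdiagram and one of its corners correspond to pairs of a subdiagram and a box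
  that can be added to it inside \<open>\<nu>\<close>.
\<close>

lemma sum_corners_reindex:
  assumes \<nu>: "young_diagram \<nu>"
  shows "(\<Sum>\<mu> | young_diagram \<mu> \<and> \<mu> \<subseteq> \<nu>. \<Sum>b\<in>corners \<mu>. f \<mu> b) =
         (\<Sum>\<kappa> | young_diagram \<kappa> \<and> \<kappa> \<subseteq> \<nu>. \<Sum>b\<in>addable \<nu> \<kappa>. f (insert b \<kappa>) b :: sym)"
proof -
  let ?Y = "{\<mu>. young_diagram \<mu> \<and> \<mu> \<subseteq> \<nu>}"
  have fin: "finite \<nu>" by (rule young_diagram_finite[OF \<nu>])
  note finY = finite_subdiagrams[OF fin]
  have finC: "\<forall>\<mu>\<in>?Y. finite (corners \<mu>)"
    using finite_subset[OF _ fin] by (auto simp: corners_def)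
  have finA: "\<forall>\<kappa>\<in>?Y. finite (addable \<nu> \<kappa>)"
    using fin by (auto simp: addable_def)
  have "(\<Sum>(\<mu>, b)\<in>Sigma ?Y corners. f \<mu> b) = (\<Sum>(\<kappa>, b)\<in>Sigma ?Y (addable \<nu>). f (insert b \<kappa>) b)"
    by (rule sum.reindex_bij_witness[where i = "\<lambda>(\<kappa>, b). (insert b \<kappa>, b)"
          and j = "\<lambda>(\<mu>, b). (\<mu> - {b}, b)"])
      (auto simp: corners_def addable_def insert_absorb)
  then show ?thesis
    by (simp add: sum.Sigma[OF finY finC] sum.Sigma[OF finY finA])
qed

theorem proposition4p9:
  fixes z z' :: complex and \<nu> :: "box set"
  assumes "young_diagram \<nu>"
  shows "laguerre_sym z z' \<nu> \<noteq> 0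
    \<and> laguerre_op z z' (laguerre_sym z z' \<nu>) = (- of_nat (card \<nu>)) *\<^sub>S laguerre_sym z z' \<nu>"
proof (intro conjI laguerre_sym_nonzero[OF assms])
  let ?Y = "{\<mu>. young_diagram \<mu> \<and> \<mu> \<subseteq> \<nu>}"
  let ?a = "laguerre_coeff z z' \<nu>" and ?w = "box_weight z z'"
  have "laguerre_op z z' (laguerre_sym z z' \<nu>) = (\<Sum>\<mu>\<in>?Y. ?a \<mu> *\<^sub>S laguerre_op_schur z z' \<mu>)"
    by (simp add: laguerre_sym_eq laguerre_op_sum laguerre_op_schur)
  also have "\<dots> = (\<Sum>\<mu>\<in>?Y. (- of_nat (card \<mu>) * ?a \<mu>) *\<^sub>S schur \<mu>) +
      (\<Sum>\<mu>\<in>?Y. \<Sum>b\<in>corners \<mu>. (?a \<mu> * ?w b) *\<^sub>S schur (\<mu> - {b}))"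
    unfolding sum.distrib[symmetric]
    by (rule sum.cong[OF refl])
      (simp only: laguerre_op_schur_def box_weight_def sym.scale_right_distrib
        sym.scale_sum_right sym.scale_scale mult.commute)
  also have "(\<Sum>\<mu>\<in>?Y. \<Sum>b\<in>corners \<mu>. (?a \<mu> * ?w b) *\<^sub>S schur (\<mu> - {b})) =
      (\<Sum>\<kappa>\<in>?Y. \<Sum>b\<in>addable \<nu> \<kappa>. (?a (insert b \<kappa>) * ?w b) *\<^sub>S schur (insert b \<kappa> - {b}))"
    by (rule sum_corners_reindex[OF assms])
  also have "\<dots> = (\<Sum>\<kappa>\<in>?Y. ((of_nat (card \<kappa>) - of_nat (card \<nu>)) * ?a \<kappa>) *\<^sub>S schur \<kappa>)"
  proof (rule sum.cong[OF refl])
    fix \<kappa> assume \<kappa>: "\<kappa> \<in> ?Y"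
    have "(\<Sum>b\<in>addable \<nu> \<kappa>. (?a (insert b \<kappa>) * ?w b) *\<^sub>S schur (insert b \<kappa> - {b})) =
        (\<Sum>b\<in>addable \<nu> \<kappa>. (?a (insert b \<kappa>) * ?w b) *\<^sub>S schur \<kappa>)"
      by (rule sum.cong[OF refl]) (simp add: addable_def)
    also have "\<dots> = (\<Sum>b\<in>addable \<nu> \<kappa>. ?a (insert b \<kappa>) * ?w b) *\<^sub>S schur \<kappa>"
      by (simp add: sym.scale_sum_left)
    also have "\<dots> = ((of_nat (card \<kappa>) - of_nat (card \<nu>)) * ?a \<kappa>) *\<^sub>S schur \<kappa>"
      using laguerre_coeff_recursion[OF assms, of \<kappa>] \<kappa> by simp
    finally show "(\<Sum>b\<in>addable \<nu> \<kappa>. (?a (insert b \<kappa>) * ?w b) *\<^sub>S schur (insert b \<kappa> - {b})) =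
        ((of_nat (card \<kappa>) - of_nat (card \<nu>)) * ?a \<kappa>) *\<^sub>S schur \<kappa>" .
  qed
  also have "(\<Sum>\<mu>\<in>?Y. (- of_nat (card \<mu>) * ?a \<mu>) *\<^sub>S schur \<mu>) + \<dots> =
      (\<Sum>\<mu>\<in>?Y. (- of_nat (card \<nu>) * ?a \<mu>) *\<^sub>S schur \<mu>)"
    by (simp add: algebra_simps flip: sum.distrib sym.scale_left_distrib)
  also have "\<dots> = (- of_nat (card \<nu>)) *\<^sub>S laguerre_sym z z' \<nu>"
    by (simp add: laguerre_sym_eq sym.scale_sum_right)
  finally show "laguerre_op z z' (laguerre_sym z z' \<nu>) =
      (- of_nat (card \<nu>)) *\<^sub>S laguerre_sym z z' \<nu>" .
qed

end
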